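(* Let $(\mathbb{X},\|\cdot\|)$ be an even dimensional, smooth and strictly convex real normed space, let $\langle\cdot,\cdot\rangle$ be a symplectic form on $\mathbb{X}$, and let $J$ be the normality map of $(\mathbb{X},\|\cdot\|)$ with respect to $\langle\cdot,\cdot\rangle$, and $J_a$ the corresponding map for the antinorm. If $M\subset\mathbb{X}$ is a convex body containing the origin as an interior point, then $\operatorname{conv}(JM)=(J_aM^\circ)^\circ$, where $J_aM^\circ=J_a(M^\circ)$.
   Context: All spaces are finite dimensional. With the dual norm $\|f\|^\ast=\sup\{f(x):\|x\|=1\}$ on $\mathbb{X}^\ast$, for $y\in\mathbb{X}$ let $f_y\in\mathbb{X}^\ast$ be the unique functional with $\|f_y\|^\ast=\|y\|$ and $f_y(y)=\|y\|^2$. The semi-inner product induced by the norm is $[x,y]=f_y(x)$, and $F:\mathbb{X}\to\mathbb{X}^\ast$ is $F(y)=f_y$. A symplectic form on $\mathbb{X}$ is a nondegenerate bilinear form with $\langle x,y\rangle=-\langle y,x\rangle$. Let $G:\mathbb{X}\to\mathbb{X}^\ast$ be the linear isomorphism $(Gx)(y)=\langle y,x\rangle$. The antinorm is $\|x\|_a=\sup\{\langle y,x\rangle:\|y\|=1\}$, again a smooth strictly convex norm; $F_a$ is the map obtained from $\|\cdot\|_a$ in the same way as $F$ from $\|\cdot\|$. The normality map is $J=G^{-1}F$, and $J_a=G^{-1}F_a$. For $K\subset\mathbb{X}$, the right semi-polar is $K^\circ=\{x\in\mathbb{X}:[x,k]\le1\text{ for all }k\in K\}$, always with respect to the semi-inner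 product $[\cdot,\cdot]$ of $\|\cdot\|$. A convex body is a compact convex set with nonempty interior. *)

theory Defs
  imports "HOL-Analysis.Analysis"
begin

definition supporting_hyperplane :: "'a::real_vector set \<Rightarrow> 'a \<Rightarrow> 'a set \<Rightarrow> bool" where
  "supporting_hyperplane K x H \<longleftrightarrow>
     (\<exists>f :: 'a \<Rightarrow> real. \<exists>c. linear f \<and> (\<exists>v. f v \<noteq> 0) \<and> H = {v. f v = c} \<and>
        x \<in> H \<and> (\<forall>v\<in>K. f v \<le> c))"

definition smooth_space :: "'a::real_normed_vector itself \<Rightarrow> bool" where
  "smooth_space _ \<longleftrightarrow> (\<forall>x::'a. norm x = 1 \<longrightarrow> (\<exists>!H. supporting_hyperplane (cball 0 1) x H))"

definition strictly_convex_space :: "'a::real_normed_vector itself \<Rightarrow> bool" where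
  "strictly_convex_space _ \<longleftrightarrow>
     (\<forall>x y::'a. x \<noteq> y \<longrightarrow> \<not> closed_segment x y \<subseteq> sphere 0 1)"

definition symplectic_form :: "('a::real_vector \<Rightarrow> 'a \<Rightarrow> real) \<Rightarrow> bool" where
  "symplectic_form \<omega> \<longleftrightarrow>
     bilinear \<omega> \<and> (\<forall>x y. \<omega> x y = - \<omega> y x) \<and> (\<forall>x. (\<forall>y. \<omega> x y = 0) \<longrightarrow> x = 0)"

(* The dual norm and the map y |-> f_y are parametrized by the norm N, because they are
   needed both for the norm of the space and for the antinorm. In finite dimension the dual
   space consists of all linear functionals, so its elements are functions f with "linear f". *)

definition dual_norm :: "('a::real_vector \<Rightarrow> real) \<Rightarrow> ('a \<Rightarrow> real) \<Rightarrow> real" where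
  "dual_norm N f = Sup {f x | x. N x = 1}"

definition duality_map :: "('a::real_vector \<Rightarrow> real) \<Rightarrow> 'a \<Rightarrow> ('a \<Rightarrow> real)" where
  "duality_map N y = (THE f. linear f \<and> dual_norm N f = N y \<and> f y = (N y)\<^sup>2)"

definition semi_inner :: "'a::real_normed_vector \<Rightarrow> 'a \<Rightarrow> real" where
  "semi_inner x y = duality_map norm y x"

definition antinorm :: "('a::real_normed_vector \<Rightarrow> 'a \<Rightarrow> real) \<Rightarrow> 'a \<Rightarrow> real" where
  "antinorm \<omega> x = Sup {\<omega> y x | y. norm y = 1}"

definition symplectic_dual :: "('a \<Rightarrow> 'a \<Rightarrow> real) \<Rightarrow> 'a \<Rightarrow> ('a \<Rightarrow> real)" where
  "symplectic_dual \<omega> x = (\<lambda>y. \<omega> y x)"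

(* symplectic_dual \<omega> is a bijection onto the linear functionals only, not onto all functions;
   inv is applied here to a linear functional. *)
definition normality_map ::
  "('a::real_vector \<Rightarrow> 'a \<Rightarrow> real) \<Rightarrow> ('a \<Rightarrow> real) \<Rightarrow> 'a \<Rightarrow> 'a" where
  "normality_map \<omega> N y = inv (symplectic_dual \<omega>) (duality_map N y)"

definition right_semi_polar :: "'a::real_normed_vector set \<Rightarrow> 'a set" where
  "right_semi_polar K = {x. \<forall>k\<in>K. semi_inner x k \<le> 1}"

definition convex_body :: "'a::real_normed_vector set \<Rightarrow> bool" where
  "convex_body K \<longleftrightarrow> compact K \<and> convex K \<and> interior K \<noteq> {}"

end

theory Submission imports Defs begin

text \<open>
  Write \<open>[x, y]\<close> for the semi-inner product, \<open>J\<close> for the normality map of the norm and \<open>J\<^sub>a\<close> for that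
  of the antinorm.  By construction \<open>[x, y] = \<omega> x (J y)\<close>, so a right semi-polar is an ordinary
  polar with respect to \<open>\<omega>\<close>: \<open>M\<^sup>\<circ>\<close> consists of all \<open>m\<close> with \<open>\<omega> m k \<le> 1\<close> for \<open>k \<in> J M\<close>.

  The antinorm of \<open>x\<close> is the dual norm of the functional \<open>\<omega> \<cdot> x\<close>.  Hence \<open>J\<close> turns the norm into the
  antinorm, and the skew symmetry of \<open>\<omega>\<close> makes the functional \<open>\<omega> \<cdot> (-y)\<close> norming for \<open>J y\<close> with
  respect to the antinorm; strict convexity says that it is the only one.  This gives
  \<open>J\<^sub>a (J y) = -y\<close>, and as \<open>J\<close> is odd and surjective also \<open>J (J\<^sub>a x) = -x\<close> (\<open>J_anti_J\<close>, \<open>J_J_anti\<close>).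
  Consequently \<open>[x, J\<^sub>a m] = \<omega> x (-m) = \<omega> m x\<close>, so that \<open>(J\<^sub>a M\<^sup>\<circ>)\<^sup>\<circ>\<close> is the set of all \<open>x\<close> with
  \<open>\<omega> m x \<le> 1\<close> for all \<open>m \<in> M\<^sup>\<circ>\<close>.  Together the two descriptions say that \<open>(J\<^sub>a M\<^sup>\<circ>)\<^sup>\<circ>\<close> is the bipolar
  of \<open>J M\<close> for the pairing \<open>\<omega>\<close>.

  The claim is therefore the bipolar theorem (\<open>symplectic_bipolar\<close>) for \<open>conv (J M)\<close>, which contains
  \<open>0 = J 0\<close>.  That no closure is needed is a compactness matter: \<open>J M\<close> is compact because \<open>J\<close> has a
  closed graph and is bounded on bounded sets, and in finite dimension the convex hull of a compact
  set is compact by Caratheodory's theorem.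

  The ambient type is a normed space with a finite spanning set, not a Euclidean space, so the
  finite-dimensional facts used above are derived from the coordinates in a basis.

  In dimension zero there are no unit vectors, and the dual norm is a supremum over the empty set.
  Whatever its value, both sides of the claim are then the whole one-point space.
\<close>

section \<open>Finite-dimensional normed spaces\<close>


lemma finite_dim_coordinates:
  assumes "\<exists>B::'a::real_normed_vector set. finite B \<and> span B = UNIV"
  obtains B :: "'a::real_normed_vector set" and c :: "'a \<Rightarrow> 'a \<Rightarrow> real"
  where "finite B" "independent B" "span B = UNIV" "\<And>b. linear (c b)"
    "\<And>x. (\<Sum>b\<in>B. c b x *\<^sub>R b) = x"
    "\<And>b u. b \<in> B \<Longrightarrow> c b (\<Sum>b\<in>B. u b *\<^sub>R b) = u b"
proof -
  obtain B0 :: "'a set" where B0: "finite B0" "span B0 = UNIV" using assms by blast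
  obtain B where B: "B \<subseteq> B0" "independent B" "B0 \<subseteq> span B"
    using maximal_independent_subset[of B0] by blast
  have fin: "finite B" using B(1) B0(1) finite_subset by blast
  have sp: "span B = UNIV" using B(3) B0(2) by (metis UNIV_I span_minimal subset_antisym subset_UNIV subspace_span)
  define c where "c = (\<lambda>b x. representation B x b)"
  have lin: "linear (c b)" for b
    unfolding c_def
    by (rule linearI) (simp_all add: real_vector.representation_add[OF B(2)] real_vector.representation_scale[OF B(2)] sp)
  have sum: "(\<Sum>b\<in>B. c b x *\<^sub>R b) = x" for x
    unfolding c_def using real_vector.sum_representation_eq[OF B(2) _ fin subset_refl] sp by simp
  have delta: "c b (\<Sum>b\<in>B. u b *\<^sub>R b) = u b" if b: "b \<in> B" for b u
  proof -
    have "c b (\<Sum>b\<in>B. u b *\<^sub>R b) = (\<Sum>b'\<in>B. u b' * c b b')"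
      by (simp add: linear_sum[OF lin] linear_cmul[OF lin])
    also have "\<dots> = (\<Sum>b'\<in>B. if b' = b then u b' else 0)"
      by (rule sum.cong) (auto simp: c_def real_vector.representation_basis[OF B(2)])
    also have "\<dots> = u b" using fin b by simp
    finally show ?thesis .
  qed
  show thesis by (rule that[OF fin B(2) sp lin sum delta])
qed

text \<open>
  Bounded coordinates force a convergent subsequence: this is Bolzano--Weierstrass applied to the
  finitely many real coordinate sequences, and makes closed balls compact.
\<close>

lemma coordinates_convergent_subseq:
  fixes c :: "'a::real_normed_vector \<Rightarrow> 'a \<Rightarrow> real" and f :: "nat \<Rightarrow> 'a"
  assumes fin: "finite B"
    and sum: "\<And>x. (\<Sum>b\<in>B. c b x *\<^sub>R b) = x"
    and delta: "\<And>b u. b \<in> B \<Longrightarrow> c b (\<Sum>b\<in>B. u b *\<^sub>R b) = u b"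
    and bdd: "\<And>b n. b \<in> B \<Longrightarrow> \<bar>c b (f n)\<bar> \<le> C"
  obtains l r where "strict_mono r" "\<And>b. b \<in> B \<Longrightarrow> (\<lambda>n. c b (f (r n))) \<longlonglongrightarrow> c b l"
    "(\<lambda>n. f (r n)) \<longlonglongrightarrow> l"
proof -
  have "\<forall>d\<subseteq>B. \<exists>l::'a. \<exists>r::nat\<Rightarrow>nat. strict_mono r \<and>
      (\<forall>e>0. eventually (\<lambda>n. \<forall>i\<in>d. dist (c i (f (r n))) (c i l) < e) sequentially)"
  proof (rule compact_lemma_general[where proj = "\<lambda>x b. c b x" and unproj = "\<lambda>u. \<Sum>b\<in>B. u b *\<^sub>R b"])
    show "bounded ((\<lambda>x. c k x) ` range f)" if "k \<in> B" for k
      using bdd[OF that] by (auto simp: bounded_iff)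
  qed (use assms in auto)
  then obtain l :: 'a and r :: "nat \<Rightarrow> nat" where r: "strict_mono r"
    and ev: "\<And>e. e > 0 \<Longrightarrow> eventually (\<lambda>n. \<forall>i\<in>B. dist (c i (f (r n))) (c i l) < e) sequentially"
    by blast
  have lim: "(\<lambda>n. c b (f (r n))) \<longlonglongrightarrow> c b l" if "b \<in> B" for b
  proof (rule tendstoI)
    fix e :: real assume "e > 0"
    from ev[OF this] show "eventually (\<lambda>n. dist (c b (f (r n))) (c b l) < e) sequentially"
      by eventually_elim (use that in auto)
  qed
  have "(\<lambda>n. \<Sum>b\<in>B. c b (f (r n)) *\<^sub>R b) \<longlonglongrightarrow> (\<Sum>b\<in>B. c b l *\<^sub>R b)"
    by (intro tendsto_sum tendsto_scaleR lim tendsto_const)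
  then have "(\<lambda>n. f (r n)) \<longlonglongrightarrow> l" by (simp only: sum)
  with r lim show thesis by (rule that)
qed

text \<open>
  All norms on a finite-dimensional space are equivalent.  If the coordinate sum norm \<open>s\<close> were not
  dominated by \<open>norm\<close>, there would be vectors with \<open>s = 1\<close> tending to \<open>0\<close> in norm; a subsequence
  converges in coordinates, and its limit would have \<open>s = 1\<close> and be \<open>0\<close>.
\<close>

lemma coordinates_bounded:
  fixes c :: "'a::real_normed_vector \<Rightarrow> 'a \<Rightarrow> real"
  assumes fin: "finite B"
    and lin: "\<And>b. linear (c b)"
    and sum: "\<And>x. (\<Sum>b\<in>B. c b x *\<^sub>R b) = x"
    and delta: "\<And>b u. b \<in> B \<Longrightarrow> c b (\<Sum>b\<in>B. u b *\<^sub>R b) = u b"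
  obtains K where "\<And>b x. b \<in> B \<Longrightarrow> \<bar>c b x\<bar> \<le> K * norm x"
proof -
  define s where "s x = (\<Sum>b\<in>B. \<bar>c b x\<bar>)" for x
  have s_scale: "s (t *\<^sub>R x) = \<bar>t\<bar> * s x" for t x
    by (simp add: s_def linear_cmul[OF lin] abs_mult sum_distrib_left)
  have le_s: "\<bar>c b x\<bar> \<le> s x" if "b \<in> B" for b x
    unfolding s_def using fin that by (intro member_le_sum) auto
  have "\<exists>K. \<forall>x. s x \<le> K * norm x"
  proof (rule ccontr)
    assume "\<nexists>K. \<forall>x. s x \<le> K * norm x"
    then have "\<forall>n::nat. \<exists>x. s x > real (Suc n) * norm x" by (meson not_le)
    then obtain g where g: "\<And>n. s (g n) > real (Suc n) * norm (g n)" by metis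
    have pos: "s (g n) > 0" for n using g[of n] by (smt (verit) mult_nonneg_nonneg norm_ge_zero of_nat_0_le_iff)
    define f where "f n = (1 / s (g n)) *\<^sub>R g n" for n
    have sf: "s (f n) = 1" for n using pos[of n] by (simp add: f_def s_scale)
    have nf: "norm (f n) \<le> 1 / real (Suc n)" for n
      using g[of n] pos[of n] by (simp add: f_def field_simps)
    have bd: "\<bar>c b (f n)\<bar> \<le> 1" if "b \<in> B" for b n using le_s[OF that, of "f n"] sf by simp
    obtain l r where r: "strict_mono r" and cl: "\<And>b. b \<in> B \<Longrightarrow> (\<lambda>n. c b (f (r n))) \<longlonglongrightarrow> c b l"
      and fl: "(\<lambda>n. f (r n)) \<longlonglongrightarrow> l"
      by (rule coordinates_convergent_subseq[where f=f, OF fin sum delta bd], assumption, assumption, rule that)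
    have "(\<lambda>n. s (f (r n))) \<longlonglongrightarrow> s l"
      unfolding s_def by (intro tendsto_sum tendsto_rabs cl)
    then have "s l = 1" by (simp add: sf LIMSEQ_const_iff)
    have "f \<longlonglongrightarrow> 0"
      by (rule Lim_null_comparison[OF always_eventually LIMSEQ_inverse_real_of_nat])
         (use nf in \<open>auto simp: inverse_eq_divide\<close>)
    then have "(\<lambda>n. f (r n)) \<longlonglongrightarrow> 0" using r LIMSEQ_subseq_LIMSEQ unfolding o_def by blast
    then have "l = 0" using fl LIMSEQ_unique by blast
    then have "s l = 0" using s_scale[of 0 0] by simp
    with \<open>s l = 1\<close> show False by simp
  qed
  then show thesis using le_s that by (meson order_trans)
qed

lemma finite_dim_bounded_linear:
  fixes f :: "'a::real_normed_vector \<Rightarrow> 'b::real_normed_vector"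
  assumes "\<exists>B::'a set. finite B \<and> span B = UNIV" and f: "linear f"
  shows "bounded_linear f"
proof -
  obtain B and c :: "'a \<Rightarrow> 'a \<Rightarrow> real" where B: "finite B" "independent B" "span B = UNIV"
    and lin: "\<And>b. linear (c b)" and sum: "\<And>x. (\<Sum>b\<in>B. c b x *\<^sub>R b) = x"
    and delta: "\<And>b u. b \<in> B \<Longrightarrow> c b (\<Sum>b\<in>B. u b *\<^sub>R b) = u b"
    using finite_dim_coordinates[OF assms(1)] by blast
  obtain K where K: "\<And>b x. b \<in> B \<Longrightarrow> \<bar>c b x\<bar> \<le> K * norm x"
    using coordinates_bounded[OF B(1) lin sum delta] by blast
  have "norm (f x) \<le> norm x * (\<Sum>b\<in>B. K * norm (f b))" for x
  proof -
    have "f x = (\<Sum>b\<in>B. c b x *\<^sub>R f b)"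
      by (subst sum[of x, symmetric]) (simp only: linear_sum[OF f] linear_cmul[OF f])
    also have "norm \<dots> \<le> (\<Sum>b\<in>B. K * norm x * norm (f b))"
      by (rule sum_norm_le) (use K in \<open>auto intro!: mult_right_mono\<close>)
    also have "\<dots> = norm x * (\<Sum>b\<in>B. K * norm (f b))"
      by (simp add: sum_distrib_left mult_ac)
    finally show ?thesis .
  qed
  then show ?thesis
    using f by (intro bounded_linear_intro[of f "\<Sum>b\<in>B. K * norm (f b)"]) (auto simp: linear_add linear_cmul)
qed

lemma finite_dim_bounded_bilinear:
  fixes h :: "'a::real_normed_vector \<Rightarrow> 'a \<Rightarrow> real"
  assumes fin: "\<exists>B::'a set. finite B \<and> span B = UNIV" and h: "bilinear h"
  shows "bounded_bilinear h"
proof -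
  obtain B and c :: "'a \<Rightarrow> 'a \<Rightarrow> real" where B: "finite B" "independent B" "span B = UNIV"
    and lin: "\<And>b. linear (c b)" and sum: "\<And>x. (\<Sum>b\<in>B. c b x *\<^sub>R b) = x"
    and delta: "\<And>b u. b \<in> B \<Longrightarrow> c b (\<Sum>b\<in>B. u b *\<^sub>R b) = u b"
    using finite_dim_coordinates[OF fin] by blast
  obtain K where K: "\<And>b x. b \<in> B \<Longrightarrow> \<bar>c b x\<bar> \<le> K * norm x"
    using coordinates_bounded[OF B(1) lin sum delta] by blast
  have l1: "linear (\<lambda>x. h x y)" and l2: "linear (h x)" for x y using h by (auto simp: bilinear_def)
  have bl: "bounded_linear (h x)" for x by (rule finite_dim_bounded_linear[OF fin l2])
  have "\<bar>h x y\<bar> \<le> norm x * norm y * (\<Sum>b\<in>B. K * onorm (h b))" for x y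
  proof -
    have "h x y = (\<Sum>b\<in>B. c b x * h b y)"
      by (subst sum[of x, symmetric]) (simp add: linear_sum[OF l1] linear_cmul[OF l1])
    also have "\<bar>\<dots>\<bar> \<le> (\<Sum>b\<in>B. \<bar>c b x\<bar> * \<bar>h b y\<bar>)"
      by (rule order_trans[OF sum_abs]) (simp add: abs_mult)
    also have "\<dots> \<le> (\<Sum>b\<in>B. (K * norm x) * (onorm (h b) * norm y))"
    proof (rule sum_mono)
      fix b assume "b \<in> B"
      then show "\<bar>c b x\<bar> * \<bar>h b y\<bar> \<le> (K * norm x) * (onorm (h b) * norm y)"
        using K[of b x] onorm[OF bl, of b y] by (intro mult_mono) (auto intro: order_trans[OF abs_ge_zero])
    qed
    also have "\<dots> = norm x * norm y * (\<Sum>b\<in>B. K * onorm (h b))"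
      by (simp add: sum_distrib_left mult_ac)
    finally show ?thesis .
  qed
  then have "\<exists>K. \<forall>a b. norm (h a b) \<le> norm a * norm b * K" by auto
  then show ?thesis
    by unfold_locales (use h in \<open>auto simp: bilinear_ladd bilinear_radd bilinear_lmul bilinear_rmul\<close>)
qed

lemma finite_dim_compact:
  fixes S :: "'a::real_normed_vector set"
  assumes fin: "\<exists>B::'a set. finite B \<and> span B = UNIV" and "closed S" and "bounded S"
  shows "compact S"
  unfolding compact_def
proof (intro allI impI)
  fix f :: "nat \<Rightarrow> 'a" assume f: "\<forall>n. f n \<in> S"
  obtain B and c :: "'a \<Rightarrow> 'a \<Rightarrow> real" where B: "finite B" "independent B" "span B = UNIV"
    and lin: "\<And>b. linear (c b)" and sum: "\<And>x. (\<Sum>b\<in>B. c b x *\<^sub>R b) = x"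
    and delta: "\<And>b u. b \<in> B \<Longrightarrow> c b (\<Sum>b\<in>B. u b *\<^sub>R b) = u b"
    using finite_dim_coordinates[OF fin] by blast
  obtain K where K: "\<And>b x. b \<in> B \<Longrightarrow> \<bar>c b x\<bar> \<le> K * norm x"
    using coordinates_bounded[OF B(1) lin sum delta] by blast
  obtain R where R: "\<And>x. x \<in> S \<Longrightarrow> norm x \<le> R" using \<open>bounded S\<close> by (auto simp: bounded_iff)
  have bd: "\<bar>c b (f n)\<bar> \<le> \<bar>K\<bar> * R" if "b \<in> B" for b n
  proof -
    have "\<bar>c b (f n)\<bar> \<le> K * norm (f n)" by (rule K[OF that])
    also have "\<dots> \<le> \<bar>K\<bar> * R" using R f by (intro mult_mono) auto
    finally show ?thesis .
  qed
  obtain l r where r: "strict_mono r" and fl: "(\<lambda>n. f (r n)) \<longlonglongrightarrow> l"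
    by (rule coordinates_convergent_subseq[where f=f, OF B(1) sum delta bd], assumption, assumption, rule that)
  have "l \<in> S" by (rule closed_sequentially[OF \<open>closed S\<close> _ fl]) (use f in auto)
  with r fl show "\<exists>l\<in>S. \<exists>r. strict_mono r \<and> (f \<circ> r) \<longlonglongrightarrow> l" by (auto simp: o_def)
qed

text \<open>
  The reduction step of Caratheodory's theorem: moving the weights \<open>u\<close> along an affine dependence \<open>w\<close>
  does not change the represented point, and at the first time \<open>t\<close> at which some weight
  vanishes all of them are still nonnegative.
\<close>

lemma convex_hull_drop_point:
  fixes S :: "'a::real_vector set"
  assumes fin: "finite S" and dep: "affine_dependent S" and y: "y \<in> convex hull S"
  obtains a where "a \<in> S" "y \<in> convex hull (S - {a})"
proof -
  obtain u where u: "\<forall>x\<in>S. 0 \<le> u x" "sum u S = 1" "(\<Sum>v\<in>S. u v *\<^sub>R v) = y"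
    using y fin by (auto simp: convex_hull_finite)
  obtain w v where w: "sum w S = 0" "v \<in> S" "w v \<noteq> 0" "(\<Sum>v\<in>S. w v *\<^sub>R v) = 0"
    using dep affine_dependent_explicit_finite[OF fin] by blast
  define N where "N = {v\<in>S. w v < 0}"
  have "N \<noteq> {}" using sum_pos2[OF fin, of v w] w unfolding N_def
    by (smt (verit, best) Collect_empty_eq)
  moreover have "finite N" using fin by (simp add: N_def)
  ultimately obtain a where a: "a \<in> N" and amin: "\<And>b. b \<in> N \<Longrightarrow> u a / (- w a) \<le> u b / (- w b)"
    using ex_min_if_finite[of "(\<lambda>b. u b / (- w b)) ` N"] by (auto simp: not_less)
  define t where "t = u a / (- w a)"
  define p where "p v = u v + t * w v" for v
  have aS: "a \<in> S" "w a < 0" using a by (auto simp: N_def)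
  then have t0: "t \<ge> 0" using u(1) unfolding t_def by (intro divide_nonneg_pos) auto
  have pa: "p a = 0" using aS by (simp add: p_def t_def)
  have pnn: "p v \<ge> 0" if "v \<in> S" for v
  proof (cases "w v < 0")
    case True
    then have "t \<le> u v / (- w v)" unfolding t_def using amin that by (simp add: N_def)
    then have "t * (- w v) \<le> u v" using True by (subst (asm) pos_le_divide_eq) auto
    then show ?thesis by (simp add: p_def)
  next
    case False then show ?thesis using t0 u(1) that by (simp add: p_def)
  qed
  have "sum p S = 1"
    using u(2) w(1) by (simp add: p_def sum.distrib sum_distrib_left[symmetric])
  moreover have "(\<Sum>v\<in>S. p v *\<^sub>R v) = y"
  proof -
    have "(\<Sum>v\<in>S. p v *\<^sub>R v) = (\<Sum>v\<in>S. u v *\<^sub>R v) + t *\<^sub>R (\<Sum>v\<in>S. w v *\<^sub>R v)"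
      by (simp add: p_def scaleR_add_left sum.distrib scaleR_right.sum)
    then show ?thesis by (simp add: u(3) w(4))
  qed
  ultimately have "sum p (S - {a}) = 1" "(\<Sum>v\<in>S - {a}. p v *\<^sub>R v) = y"
    using pa by (simp_all add: sum_diff1[OF fin])
  then have "y \<in> convex hull (S - {a})"
    using fin pnn by (auto simp: convex_hull_finite)
  with aS(1) show thesis by (rule that)
qed

text \<open>
  In a representation with the fewest points, these are affinely independent, so their differences
  from one of them form an independent set.
\<close>

lemma finite_dim_caratheodory:
  fixes C :: "'a::real_normed_vector set"
  assumes B: "finite B" "span B = (UNIV :: 'a set)" and y: "y \<in> convex hull C"
  obtains S where "finite S" "S \<subseteq> C" "card S \<le> card B + 1" "y \<in> convex hull S"
proof -
  let ?P = "\<lambda>S. finite S \<and> S \<subseteq> C \<and> y \<in> convex hull S"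
  obtain S0 u where "finite S0" "S0 \<subseteq> C" "\<forall>x\<in>S0. 0 \<le> u x" "sum u S0 = 1" "(\<Sum>v\<in>S0. u v *\<^sub>R v) = y"
    using y unfolding convex_hull_explicit by blast
  then have "?P S0" by (auto simp: convex_hull_finite)
  from ex_has_least_nat[of ?P, OF this, of card]
  obtain S where S: "finite S" "S \<subseteq> C" "y \<in> convex hull S"
    and min: "\<And>T. finite T \<Longrightarrow> T \<subseteq> C \<Longrightarrow> y \<in> convex hull T \<Longrightarrow> card S \<le> card T"
    by blast
  have "\<not> affine_dependent S"
  proof
    assume "affine_dependent S"
    then obtain a where "a \<in> S" "y \<in> convex hull (S - {a})"
      using convex_hull_drop_point[OF S(1) _ S(3)] by blast
    moreover from this have "card S \<le> card (S - {a})" using S(1,2) by (intro min) auto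
    ultimately show False using card_Diff1_less[OF S(1), of a] by simp
  qed
  have "card S \<le> card B + 1"
  proof (cases "S = {}")
    case False
    then obtain a where a: "a \<in> S" by blast
    then have "independent ((\<lambda>x. - a + x) ` (S - {a}))"
      using \<open>\<not> affine_dependent S\<close> affine_dependent_iff_dependent2 by blast
    then have "card ((\<lambda>x. - a + x) ` (S - {a})) \<le> card B"
      using independent_span_bound[OF B(1)] B(2) by blast
    moreover have "card ((\<lambda>x. - a + x) ` (S - {a})) = card (S - {a})"
      by (rule card_image) simp
    ultimately show ?thesis using a S by (simp add: card_Diff_singleton)
  qed auto
  with S show thesis by (intro that)
qed

text \<open>
  By Caratheodory's theorem every point of the hull is reached from \<open>C\<close> in a fixed number of steps,
  each of which joins a point of \<open>C\<close> to an earlier one by a segment; a single such step preserves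
  compactness.
\<close>

lemma finite_dim_compact_convex_hull:
  fixes C :: "'a::real_normed_vector set"
  assumes "\<exists>B::'a set. finite B \<and> span B = UNIV" and C: "compact C"
  shows "compact (convex hull C)"
proof -
  obtain B :: "'a set" where B: "finite B" "span B = UNIV" using assms(1) by blast
  define step where "step T = {(1 - u) *\<^sub>R x + u *\<^sub>R y | x y u. 0 \<le> u \<and> u \<le> 1 \<and> x \<in> C \<and> y \<in> T}" for T
  define D where "D n = (step ^^ n) C" for n
  have comp: "compact (D n)" for n
    by (induction n) (auto simp: D_def C step_def intro: compact_convex_combinations)
  have sub: "D n \<subseteq> convex hull C" for n
  proof (induction n)
    case (Suc n)
    have "(1 - u) *\<^sub>R x + u *\<^sub>R y \<in> convex hull C"
      if "0 \<le> u" "u \<le> 1" "x \<in> C" "y \<in> D n" for u x y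
      by (rule convexD[OF convex_convex_hull]) (use that Suc hull_inc in auto)
    then show ?case by (auto simp: D_def step_def)
  qed (simp add: D_def hull_subset)
  have hull: "convex hull S \<subseteq> D n" if "S \<subseteq> C" "finite S" "card S \<le> n + 1" for S n
    using that
  proof (induction n arbitrary: S)
    case 0
    then have "S = {} \<or> (\<exists>a. S = {a})" by (metis One_nat_def add_0 card_0_eq card_1_singletonE le_Suc_eq le_zero_eq)
    then show ?case using 0 by (auto simp: D_def)
  next
    case (Suc n)
    show ?case
    proof (cases "\<exists>a T. S = insert a T \<and> a \<notin> T \<and> T \<noteq> {}")
      case True
      then obtain a T where S: "S = insert a T" "a \<notin> T" "T \<noteq> {}" by blast
      then have "convex hull T \<subseteq> D n" using Suc by auto
      moreover have "a \<in> C" using S Suc by auto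
      ultimately have "u *\<^sub>R a + v *\<^sub>R b \<in> step (D n)"
        if "0 \<le> u" "0 \<le> v" "u + v = 1" "b \<in> convex hull T" for u v b
      proof -
        have "u = 1 - v" "v \<le> 1" using that by auto
        then show ?thesis using \<open>convex hull T \<subseteq> D n\<close> \<open>a \<in> C\<close> that unfolding step_def by blast
      qed
      then show ?thesis
        unfolding S(1) convex_hull_insert[OF S(3)] by (auto simp: D_def)
    next
      case False
      show ?thesis
      proof
        fix x assume "x \<in> convex hull S"
        then obtain a where "a \<in> S" by fastforce
        then have "S = {a}" using False by (metis mk_disjoint_insert)
        then have "x = a" using \<open>x \<in> convex hull S\<close> by simp
        have "convex hull {a} \<subseteq> D n" by (rule Suc.IH) (use Suc.prems \<open>a \<in> S\<close> in auto)
        then have "a \<in> D n" by simp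
        moreover have "a \<in> C" using \<open>a \<in> S\<close> Suc.prems(1) by blast
        ultimately have "(1 - 1) *\<^sub>R a + 1 *\<^sub>R a \<in> step (D n)" unfolding step_def
          by (intro CollectI exI[of _ a] exI[of _ "1::real"]) auto
        then show "x \<in> D (Suc n)" by (simp add: \<open>x = a\<close> D_def)
      qed
    qed
  qed
  have "convex hull C = D (card B)"
  proof
    show "convex hull C \<subseteq> D (card B)"
    proof
      fix y assume "y \<in> convex hull C"
      then obtain S where "finite S" "S \<subseteq> C" "card S \<le> card B + 1" "y \<in> convex hull S"
        using finite_dim_caratheodory[OF B] by blast
      then show "y \<in> D (card B)" using hull by blast
    qed
  qed (rule sub)
  with comp show ?thesis by simp
qed

text \<open>
  The norm need not come from an inner product, but the coordinates provide an auxiliary one, \<open>p\<close>.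
  The separating functional is \<open>p z\<close>, where \<open>z\<close> points from the \<open>p\<close>-nearest point \<open>k0\<close> of \<open>K\<close> to \<open>x\<close>.
\<close>

lemma finite_dim_separation:
  fixes K :: "'a::real_normed_vector set"
  assumes fin: "\<exists>B::'a set. finite B \<and> span B = UNIV"
    and K: "compact K" "convex K" "K \<noteq> {}" and x: "x \<notin> K"
  obtains f :: "'a \<Rightarrow> real" and a where "linear f" "\<And>k. k \<in> K \<Longrightarrow> f k \<le> a" "a < f x"
proof -
  obtain B and c :: "'a \<Rightarrow> 'a \<Rightarrow> real" where B: "finite B"
    and lin: "\<And>b. linear (c b)" and sum: "\<And>x. (\<Sum>b\<in>B. c b x *\<^sub>R b) = x"
    using finite_dim_coordinates[OF fin] by metis
  define p where "p u v = (\<Sum>b\<in>B. c b u * c b v)" for u v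
  have p_lin: "linear (p u)" for u
    by (rule linearI) (simp_all add: p_def linear_add[OF lin] linear_cmul[OF lin] distrib_left
        sum.distrib sum_distrib_left mult_ac)
  have p_sym: "p u v = p v u" for u v by (simp add: p_def mult.commute)
  have p_pos: "p u u > 0" if "u \<noteq> 0" for u
  proof -
    have "p u u \<ge> 0" by (simp add: p_def sum_nonneg)
    moreover have "p u u \<noteq> 0"
    proof
      assume "p u u = 0"
      then have "\<forall>b\<in>B. c b u = 0" using B by (simp add: p_def sum_nonneg_eq_0_iff)
      then show False using sum[of u] that by simp
    qed
    ultimately show ?thesis by simp
  qed
  have c_cont: "continuous_on UNIV (c b)" for b
    using finite_dim_bounded_linear[OF fin lin] by (simp add: linear_continuous_on)
  have "continuous_on K (\<lambda>k. p (x - k) (x - k))"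
    unfolding p_def by (intro continuous_intros continuous_on_compose2[OF c_cont]) auto
  then obtain k0 where k0: "k0 \<in> K" and min: "\<And>k. k \<in> K \<Longrightarrow> p (x - k0) (x - k0) \<le> p (x - k) (x - k)"
    using continuous_attains_inf[OF K(1,3)] by blast
  define z where "z = x - k0"
  have "z \<noteq> 0" using k0 x by (auto simp: z_def)
  have le: "p z k \<le> p z k0" if k: "k \<in> K" for k
  proof (rule ccontr)
    define d where "d = k - k0"
    assume "\<not> p z k \<le> p z k0"
    then have pos: "p z d > 0" by (simp add: d_def linear_diff[OF p_lin])
    then have "d \<noteq> 0" by (auto simp: linear_0[OF p_lin])
    \<comment> \<open>Moving from \<open>k0\<close> towards \<open>k\<close> by this much stays in \<open>K\<close> and gets closer to \<open>x\<close>.\<close>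
    define t where "t = min 1 (p z d / p d d)"
    have t: "0 < t" "t \<le> 1" "t * p d d \<le> p z d"
      using pos p_pos[OF \<open>d \<noteq> 0\<close>] by (auto simp: t_def min_def field_simps)
    have "(1 - t) *\<^sub>R k0 + t *\<^sub>R k \<in> K" using convexD[OF K(2) k0 k, of "1 - t" t] t by simp
    moreover have "x - ((1 - t) *\<^sub>R k0 + t *\<^sub>R k) = z - t *\<^sub>R d" by (simp add: z_def d_def algebra_simps)
    ultimately have "p z z \<le> p (z - t *\<^sub>R d) (z - t *\<^sub>R d)" using min unfolding z_def by metis
    also have "\<dots> = p z z - t * (2 * p z d - t * p d d)"
      by (simp add: linear_diff[OF p_lin] linear_cmul[OF p_lin] p_sym[of "z - t *\<^sub>R d"] p_sym[of d z] algebra_simps)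
    finally have "t * (2 * p z d - t * p d d) \<le> 0" by simp
    then show False using t pos by (simp add: mult_le_0_iff)
  qed
  have "p z x - p z k0 = p z z" by (simp add: z_def linear_diff[OF p_lin])
  then have "p z k0 < p z x" using p_pos[OF \<open>z \<noteq> 0\<close>] by simp
  with p_lin le show thesis by (rule that)
qed

section \<open>Norming functionals\<close>

text \<open>
  The defining property of the functional \<open>f\<^sub>y\<close>, with the dual norm replaced by a pointwise bound.
  Unlike a supremum, this form makes sense and passes to limits without further hypotheses.
  The norm is a parameter because the antinorm is used as well.
\<close>

definition norming_functional :: "('a::real_vector \<Rightarrow> real) \<Rightarrow> 'a \<Rightarrow> ('a \<Rightarrow> real) \<Rightarrow> bool" where
  "norming_functional N y f \<longleftrightarrow> linear f \<and> (\<forall>v. f v \<le> N y * N v) \<and> f y = (N y)\<^sup>2"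

lemma dual_norm_le:
  assumes "\<exists>x. N x = 1" and "\<And>v. f v \<le> C * N v"
  shows "dual_norm N f \<le> C"
  unfolding dual_norm_def
proof (rule cSup_least)
  show "{f x |x. N x = 1} \<noteq> {}" using assms(1) by blast
next
  fix a assume "a \<in> {f x |x. N x = 1}"
  then obtain x where "a = f x" "N x = 1" by blast
  then show "a \<le> C" using assms(2)[of x] by simp
qed

lemma le_dual_norm:
  fixes f :: "'a::real_vector \<Rightarrow> real"
  assumes hom: "\<And>t v. N (t *\<^sub>R v) = \<bar>t\<bar> * N v" and pos: "\<And>v. v \<noteq> 0 \<Longrightarrow> N v > 0"
    and f: "linear f" and bd: "\<And>v. f v \<le> C * N v"
  shows "f v \<le> dual_norm N f * N v"
proof (cases "v = 0")
  case True
  then show ?thesis using hom[of 0 0] by (simp add: linear_0[OF f])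
next
  case False
  note p = pos[OF False]
  define u where "u = (1 / N v) *\<^sub>R v"
  have Nu: "N u = 1" using p by (simp add: u_def hom)
  have "bdd_above {f x |x. N x = 1}"
  proof (rule bdd_aboveI)
    fix a assume "a \<in> {f x |x. N x = 1}"
    then obtain x where "a = f x" "N x = 1" by blast
    then show "a \<le> C" using bd[of x] by simp
  qed
  then have "f u \<le> dual_norm N f"
    unfolding dual_norm_def by (rule cSup_upper[rotated]) (use Nu in blast)
  then show ?thesis using p by (simp add: u_def linear_cmul[OF f] field_simps)
qed

text \<open>
  The bound \<open>bd\<close> makes the supremum in the dual norm a genuine one.  At \<open>y = 0\<close> both sides say that
  \<open>f\<close> vanishes; a nonzero vector is needed for the unit sphere to be nonempty.
\<close>

lemma norming_functional_iff_dual_norm: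
  fixes f :: "'a::real_vector \<Rightarrow> real"
  assumes hom: "\<And>t v. N (t *\<^sub>R v) = \<bar>t\<bar> * N v" and pos: "\<And>v. v \<noteq> 0 \<Longrightarrow> N v > 0"
    and nontriv: "\<exists>v::'a. v \<noteq> 0" and bd: "linear f \<Longrightarrow> \<exists>C. \<forall>v. f v \<le> C * N v"
  shows "linear f \<and> dual_norm N f = N y \<and> f y = (N y)\<^sup>2 \<longleftrightarrow> norming_functional N y f"
proof
  assume "linear f \<and> dual_norm N f = N y \<and> f y = (N y)\<^sup>2"
  then show "norming_functional N y f"
    unfolding norming_functional_def using le_dual_norm[OF hom pos] bd by metis
next
  assume *: "norming_functional N y f"
  then have f: "linear f" and le: "\<And>v. f v \<le> N y * N v" and fy: "f y = (N y)\<^sup>2"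
    by (auto simp: norming_functional_def)
  obtain u :: 'a where u: "u \<noteq> 0" using nontriv by blast
  have "N ((1 / N u) *\<^sub>R u) = 1" using pos[OF u] by (simp add: hom)
  then have "dual_norm N f \<le> N y" by (intro dual_norm_le le) blast
  moreover have "N y \<le> dual_norm N f"
  proof (cases "y = 0")
    case True
    then have "N y = 0" using hom[of 0 0] by simp
    then have "f u \<le> 0" "f (- u) \<le> 0" using le[of u] le[of "-u"] by simp_all
    then have "f u = 0" by (simp add: linear_neg[OF f])
    then have "0 \<le> dual_norm N f * N u" using le_dual_norm[OF hom pos f le, of u] by simp
    then show ?thesis using pos[OF u] \<open>N y = 0\<close> by (simp add: zero_le_mult_iff)
  next
    case False
    have "N y * N y \<le> dual_norm N f * N y"
      using le_dual_norm[OF hom pos f le, of y] fy by (simp add: power2_eq_square)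
    then show ?thesis using pos[OF False] by simp
  qed
  ultimately show "linear f \<and> dual_norm N f = N y \<and> f y = (N y)\<^sup>2" using f fy by simp
qed

text \<open>
  A supporting hyperplane of the unit ball at the direction of \<open>y\<close> is the level set of a functional
  that attains its norm there; rescaling it gives the norming functional.
\<close>

lemma norming_functional_exists:
  fixes y :: "'a::real_normed_vector"
  assumes smooth: "smooth_space TYPE('a)"
  shows "\<exists>f. norming_functional norm y f"
proof (cases "y = 0")
  case True
  then show ?thesis by (auto simp: norming_functional_def intro!: exI[of _ "\<lambda>_. 0"] linear_zero)
next
  case False
  define e where "e = y /\<^sub>R norm y"
  have "norm e = 1" using False by (simp add: e_def)
  then obtain H where "supporting_hyperplane (cball 0 1) e H" using smooth unfolding smooth_space_def by blast
  then obtain f :: "'a \<Rightarrow> real" and c w where f: "linear f" and w: "f w \<noteq> 0" and fe: "f e = c"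
    and le: "\<And>v. norm v \<le> 1 \<Longrightarrow> f v \<le> c"
    by (auto simp: supporting_hyperplane_def)
  have le': "f v \<le> c * norm v" for v
  proof (cases "v = 0")
    case False
    have "f (v /\<^sub>R norm v) \<le> c" using False by (intro le) simp
    then show ?thesis using False by (simp add: linear_cmul[OF f] field_simps)
  qed (simp add: linear_0[OF f])
  have "c > 0"
  proof (rule ccontr)
    assume "\<not> c > 0"
    then have "f v \<le> 0" for v using le'[of v] by (smt (verit) mult_nonpos_nonneg norm_ge_zero)
    from this[of w] this[of "- w"] show False using w by (simp add: linear_neg[OF f])
  qed
  define g where "g v = (norm y / c) * f v" for v
  have "linear g" unfolding g_def using f
    by (auto intro!: linearI simp: linear_add linear_cmul add_divide_distrib distrib_left)
  moreover have "g v \<le> norm y * norm v" for v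
    using mult_left_mono[OF le'[of v], of "norm y / c"] \<open>c > 0\<close> by (simp add: g_def)
  moreover have "g y = (norm y)\<^sup>2"
  proof -
    have "f y = c * norm y" using fe False by (simp add: e_def linear_cmul[OF f] field_simps)
    then show ?thesis using \<open>c > 0\<close> by (simp add: g_def power2_eq_square)
  qed
  ultimately show ?thesis by (auto simp: norming_functional_def)
qed

text \<open>
  A norming functional of \<open>y \<noteq> 0\<close> is recovered from its level set of height \<open>norm y\<close>, which supports the
  unit ball at the direction of \<open>y\<close>; smoothness says that there is only one such hyperplane.
\<close>

lemma norming_functional_unique:
  fixes y :: "'a::real_normed_vector"
  assumes smooth: "smooth_space TYPE('a)"
    and "norming_functional norm y f" "norming_functional norm y g"
  shows "f = g"
proof (cases "y = 0")
  case True
  have "h = (\<lambda>_. 0)" if "norming_functional norm y h" for h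
  proof
    fix v
    have h: "linear h" and le: "\<And>v. h v \<le> 0"
      using that True by (auto simp: norming_functional_def)
    show "h v = 0" using le[of v] le[of "- v"] by (simp add: linear_neg[OF h])
  qed
  then show ?thesis using assms by blast
next
  case False
  define e where "e = y /\<^sub>R norm y"
  define a where "a = norm y"
  have a: "a > 0" using False by (simp add: a_def)
  have e: "norm e = 1" using False by (simp add: e_def)
  have sup: "supporting_hyperplane (cball 0 1) e {v. h v = a}" and lin: "linear h"
    if "norming_functional norm y h" for h
  proof -
    show h: "linear h" using that by (simp add: norming_functional_def)
    have "h e = a" using that False
      by (simp add: norming_functional_def e_def a_def linear_cmul power2_eq_square)
    moreover have "h v \<le> a" if "norm v \<le> 1" for v
    proof -
      have "h v \<le> norm y * norm v" using \<open>norming_functional norm y h\<close> by (simp add: norming_functional_def)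
      also have "\<dots> \<le> a" using that by (simp add: a_def mult_left_le)
      finally show ?thesis .
    qed
    ultimately show "supporting_hyperplane (cball 0 1) e {v. h v = a}"
      unfolding supporting_hyperplane_def using h a
      by (intro exI[of _ h] exI[of _ a]) (auto intro!: exI[of _ e])
  qed
  have "{v. f v = a} = {v. g v = a}"
    using smooth e sup assms(2,3) unfolding smooth_space_def by blast
  then have level: "f v = a \<longleftrightarrow> g v = a" for v by blast
  have eq: "h v = k v"
    if "h v \<noteq> 0" "linear h" "linear k" "\<And>v. h v = a \<longleftrightarrow> k v = a" for h k and v :: 'a
  proof -
    have "h ((a / h v) *\<^sub>R v) = a" using that by (simp add: linear_cmul)
    then have "k ((a / h v) *\<^sub>R v) = a" using that by blast
    then show ?thesis using that a by (simp add: linear_cmul field_simps)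
  qed
  show ?thesis
  proof
    fix v
    show "f v = g v"
      using eq[of f v g, OF _ lin[OF assms(2)] lin[OF assms(3)] level]
        eq[of g v f, OF _ lin[OF assms(3)] lin[OF assms(2)] level[symmetric]] by metis
  qed
qed

text \<open>
  Compactness of the unit sphere yields a unit vector \<open>u\<close> at which \<open>f\<close> is largest, and \<open>f\<close> is then
  the norming functional of \<open>f u *\<^sub>R u\<close>.  This is the surjectivity of the duality map.
\<close>

lemma linear_attains_norm:
  fixes f :: "'a::real_normed_vector \<Rightarrow> real"
  assumes fin: "\<exists>B::'a set. finite B \<and> span B = UNIV" and f: "linear f"
  obtains y where "norming_functional norm y f"
proof (cases "\<exists>v::'a. v \<noteq> 0")
  case False
  then have "f v = 0" for v using linear_0[OF f] by metis
  then have "norming_functional norm 0 f" using f by (simp add: norming_functional_def)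
  then show thesis by (rule that)
next
  case True
  then obtain v :: 'a where "v \<noteq> 0" by blast
  then have "v /\<^sub>R norm v \<in> sphere 0 1" by simp
  then have ne: "sphere (0::'a) 1 \<noteq> {}" by blast
  have "closed {v :: 'a. norm v = 1}"
    by (intro closed_Collect_eq continuous_intros)
  then have "closed (sphere (0::'a) 1)" by (simp add: sphere_def)
  then have "compact (sphere (0::'a) 1)"
    by (rule finite_dim_compact[OF fin]) (auto intro: bounded_subset[of "cball 0 1"])
  moreover have "continuous_on (sphere 0 1) f"
    using finite_dim_bounded_linear[OF fin f] by (rule linear_continuous_on)
  ultimately obtain u where u: "norm u = 1" and max: "\<And>v. norm v = 1 \<Longrightarrow> f v \<le> f u"
    using continuous_attains_sup[OF _ ne] by (metis mem_sphere_0)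
  have "f (- u) \<le> f u" using u by (intro max) simp
  then have fu: "f u \<ge> 0" by (simp add: linear_neg[OF f])
  have "f v \<le> f u * norm v" for v
  proof (cases "v = 0")
    case False
    have "f (v /\<^sub>R norm v) \<le> f u" using False by (intro max) simp
    then show ?thesis using False by (simp add: linear_cmul[OF f] field_simps)
  qed (simp add: linear_0[OF f])
  then have "norming_functional norm (f u *\<^sub>R u) f"
    using f fu u by (auto simp: norming_functional_def linear_cmul power2_eq_square)
  then show thesis by (rule that)
qed

section \<open>Symplectic forms\<close>

lemma symplectic_formD:
  assumes "symplectic_form \<omega>"
  shows "bilinear \<omega>" "linear (\<lambda>x. \<omega> x y)" "linear (\<omega> x)" "\<omega> x y = - \<omega> y x"
    "(\<And>v. \<omega> x v = 0) \<Longrightarrow> x = 0"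
proof -
  note * = assms[unfolded symplectic_form_def]
  show b: "bilinear \<omega>" using * by (elim conjE)
  then show "linear (\<lambda>x. \<omega> x y)" "linear (\<omega> x)" by (auto simp: bilinear_def)
  show "\<omega> x y = - \<omega> y x" using *[THEN conjunct2, THEN conjunct1] by (elim allE)
  show "x = 0" if "\<And>v. \<omega> x v = 0"
    using *[THEN conjunct2, THEN conjunct2, rule_format] that by blast
qed

text \<open>
  The map \<open>L\<close> sends \<open>x\<close> to the vector whose coordinates are the values of \<open>\<omega> \<cdot> x\<close> on the basis.
  Nondegeneracy makes it an injective endomorphism, hence a surjective one.
\<close>

lemma symplectic_represents:
  fixes \<omega> :: "'a::real_normed_vector \<Rightarrow> 'a \<Rightarrow> real"
  assumes fin: "\<exists>B::'a set. finite B \<and> span B = UNIV" and sympl: "symplectic_form \<omega>" and f: "linear f"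
  obtains z where "\<And>v. f v = \<omega> v z"
proof -
  obtain B and c :: "'a \<Rightarrow> 'a \<Rightarrow> real" where B: "finite B" "independent B" "span B = UNIV"
    and lin: "\<And>b. linear (c b)" and sum: "\<And>x. (\<Sum>b\<in>B. c b x *\<^sub>R b) = x"
    and delta: "\<And>b u. b \<in> B \<Longrightarrow> c b (\<Sum>b\<in>B. u b *\<^sub>R b) = u b"
    using finite_dim_coordinates[OF fin] by blast
  have fd: "finite_dimensional_vector_space ((*\<^sub>R) :: real \<Rightarrow> 'a \<Rightarrow> 'a) B"
    using B real_vector.vector_space_axioms
    unfolding finite_dimensional_vector_space_def finite_dimensional_vector_space_axioms_def
      dependent_raw_def span_raw_def by blast
  have l1: "linear (\<lambda>x. \<omega> x y)" and l2: "linear (\<omega> x)" for x y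
    by (rule symplectic_formD[OF sympl])+
  have expand: "h v = (\<Sum>b\<in>B. c b v * h b)" if "linear h" for h :: "'a \<Rightarrow> real" and v
    by (subst sum[of v, symmetric]) (simp add: linear_sum[OF that] linear_cmul[OF that])
  define L where "L x = (\<Sum>b\<in>B. \<omega> b x *\<^sub>R b)" for x
  have linL: "linear L"
    by (rule linearI) (simp_all add: L_def linear_add[OF l2] linear_cmul[OF l2] scaleR_add_left
        sum.distrib scaleR_right.sum)
  have "inj L"
    unfolding linear_injective_0[OF linL]
  proof (intro allI impI)
    fix x assume "L x = 0"
    then have "\<omega> b x = 0" if "b \<in> B" for b
      using delta[OF that, of "\<lambda>b. \<omega> b x"] linear_0[OF lin[of b]] by (simp add: L_def)
    then have "\<omega> v x = 0" for v using expand[OF l1[of x], of v] by simp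
    then have "\<omega> x v = 0" for v using symplectic_formD(4)[OF sympl, of x v] by simp
    then show "x = 0" by (intro symplectic_formD(5)[OF sympl])
  qed
  then have "surj L" using finite_dimensional_vector_space.linear_inj_imp_surj[OF fd] linL by (simp add: linear_def)
  then obtain z where "L z = (\<Sum>b\<in>B. f b *\<^sub>R b)" by (metis surjD)
  then have "\<omega> b z = f b" if "b \<in> B" for b
    using delta[OF that, of "\<lambda>b. \<omega> b z"] delta[OF that, of f] by (simp add: L_def)
  then have "f v = \<omega> v z" for v
    using expand[OF f, of v] expand[OF l1[of z], of v] by simp
  then show thesis by (rule that)
qed

section \<open>Normality maps of the norm and of the antinorm\<close>

text \<open>
  A nonzero vector is required so that there are unit vectors: otherwise the dual norm is a supremum
  over the empty set.
\<close>

locale smooth_symplectic_space =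
  fixes \<omega> :: "'a::real_normed_vector \<Rightarrow> 'a \<Rightarrow> real"
  assumes fin: "\<exists>B::'a set. finite B \<and> span B = UNIV"
    and smooth: "smooth_space TYPE('a)"
    and strict: "strictly_convex_space TYPE('a)"
    and sympl: "symplectic_form \<omega>"
    and nontriv: "\<exists>v::'a. v \<noteq> 0"
begin

abbreviation J :: "'a \<Rightarrow> 'a" where "J \<equiv> normality_map \<omega> norm"
abbreviation J_anti :: "'a \<Rightarrow> 'a" where "J_anti \<equiv> normality_map \<omega> (antinorm \<omega>)"

lemma omega_linear: "linear (\<lambda>x. \<omega> x y)" "linear (\<omega> x)"
  by (rule symplectic_formD[OF sympl])+

lemma omega_skew: "\<omega> x y = - \<omega> y x"
  by (rule symplectic_formD(4)[OF sympl])

lemma omega_simps: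
  "\<omega> (- x) y = - \<omega> x y" "\<omega> x (- y) = - \<omega> x y"
  "\<omega> (t *\<^sub>R x) y = t * \<omega> x y" "\<omega> x (t *\<^sub>R y) = t * \<omega> x y"
  using linear_neg[OF omega_linear(1)] linear_neg[OF omega_linear(2)]
    linear_cmul[OF omega_linear(1)] linear_cmul[OF omega_linear(2)] by auto

lemma omega_represents:
  assumes "linear f"
  shows "\<exists>z. f = (\<lambda>v. \<omega> v z)"
proof -
  obtain z where "\<And>v. f v = \<omega> v z" by (rule symplectic_represents[OF fin sympl assms], rule that)
  then show ?thesis by blast
qed

lemma omega_inject:
  assumes "\<And>v. \<omega> v x = \<omega> v y"
  shows "x = y"
proof -
  have "\<omega> (x - y) v = 0" for v
    using assms[of v] omega_skew[of x v] omega_skew[of y v] by (simp add: linear_diff[OF omega_linear(1)])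
  then have "x - y = 0" by (intro symplectic_formD(5)[OF sympl])
  then show ?thesis by simp
qed

lemma duality_map_norm:
  fixes y :: 'a
  assumes "norming_functional norm y f"
  shows "duality_map norm y = f"
proof -
  have "linear f \<and> dual_norm norm f = norm y \<and> f y = (norm y)\<^sup>2 \<longleftrightarrow> norming_functional norm y f" for f
  proof (rule norming_functional_iff_dual_norm)
    assume "linear f"
    then obtain z where "norming_functional norm z f" by (rule linear_attains_norm[OF fin])
    then show "\<exists>C. \<forall>v. f v \<le> C * norm v" unfolding norming_functional_def by blast
  qed (use nontriv in auto)
  then have "duality_map norm y = (THE f. norming_functional norm y f)"
    unfolding duality_map_def by presburger
  also have "\<dots> = f"
    using assms norming_functional_unique[OF smooth] by (intro the_equality)
  finally show ?thesis .
qed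

lemma normality_map_eq:
  assumes "duality_map N y = (\<lambda>v. \<omega> v z)"
  shows "normality_map \<omega> N y = z"
proof -
  have "inj (symplectic_dual \<omega>)"
    by (auto simp: inj_on_def symplectic_dual_def fun_eq_iff intro: omega_inject)
  moreover have "duality_map N y = symplectic_dual \<omega> z" using assms by (simp add: symplectic_dual_def)
  ultimately show ?thesis by (simp add: normality_map_def)
qed

text \<open>
  This characterization of \<open>J y\<close> by inequalities replaces the definite description and the inverse in
  the definition of the normality map.
\<close>

lemma normality_map_iff: "norming_functional norm y (\<lambda>v. \<omega> v z) \<longleftrightarrow> J y = z"
proof
  assume "norming_functional norm y (\<lambda>v. \<omega> v z)"
  then show "J y = z" by (intro normality_map_eq duality_map_norm)
next
  assume z: "J y = z"
  obtain f where f: "norming_functional norm y f" using norming_functional_exists[OF smooth] by blast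
  then obtain w where w: "f = (\<lambda>v. \<omega> v w)"
    using omega_represents unfolding norming_functional_def by blast
  then have "J y = w" using f by (intro normality_map_eq duality_map_norm) simp
  then show "norming_functional norm y (\<lambda>v. \<omega> v z)" using f w z by simp
qed

lemma omega_J_le: "\<omega> v (J y) \<le> norm y * norm v"
  and omega_J_self: "\<omega> y (J y) = (norm y)\<^sup>2"
proof -
  have "norming_functional norm y (\<lambda>v. \<omega> v (J y))" by (simp add: normality_map_iff)
  then show "\<omega> v (J y) \<le> norm y * norm v" "\<omega> y (J y) = (norm y)\<^sup>2"
    unfolding norming_functional_def by blast+
qed

lemma semi_inner_eq: "semi_inner x y = \<omega> x (J y)"
  unfolding semi_inner_def by (simp add: duality_map_norm[of y "\<lambda>v. \<omega> v (J y)"] normality_map_iff)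

lemma J_scale: "J (t *\<^sub>R y) = t *\<^sub>R J y"
proof (subst normality_map_iff[symmetric])
  have "\<omega> v (t *\<^sub>R J y) \<le> norm (t *\<^sub>R y) * norm v" for v
    using omega_J_le[of "t *\<^sub>R v" y] by (simp add: omega_simps mult_ac)
  then show "norming_functional norm (t *\<^sub>R y) (\<lambda>v. \<omega> v (t *\<^sub>R J y))"
    using omega_linear(1)[of "t *\<^sub>R J y"]
    by (simp add: norming_functional_def omega_simps omega_J_self power_mult_distrib power2_eq_square)
qed

lemma J_minus: "J (- y) = - J y"
  using J_scale[of "-1" y] by simp

lemma J_zero: "J 0 = 0"
  using J_scale[of 0 0] by simp

lemma surj_J: "surj J"
proof -
  have "\<exists>y. x = J y" for x
  proof -
    obtain y where "norming_functional norm y (\<lambda>v. \<omega> v x)"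
      by (rule linear_attains_norm[OF fin omega_linear(1)])
    then have "J y = x" by (simp only: normality_map_iff)
    then show ?thesis by blast
  qed
  then show ?thesis by blast
qed

lemma antinorm_J: "antinorm \<omega> (J y) = norm y"
proof -
  have "dual_norm norm (\<lambda>v. \<omega> v (J y)) = norm y"
    using norming_functional_iff_dual_norm[of norm "\<lambda>v. \<omega> v (J y)" y] nontriv omega_J_le
      normality_map_iff[of y "J y"] by auto
  then show ?thesis by (simp add: antinorm_def dual_norm_def)
qed

lemma antinorm_scale: "antinorm \<omega> (t *\<^sub>R x) = \<bar>t\<bar> * antinorm \<omega> x"
proof -
  obtain y where "x = J y" using surj_J by blast
  then have "t *\<^sub>R x = J (t *\<^sub>R y)" by (simp add: J_scale)
  then show ?thesis using \<open>x = J y\<close> by (simp only: antinorm_J norm_scaleR)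
qed

lemma antinorm_pos: "x \<noteq> 0 \<Longrightarrow> antinorm \<omega> x > 0"
  using surj_J antinorm_J J_zero by (metis surjD zero_less_norm_iff)

lemma omega_le_antinorm: "\<omega> v x \<le> norm v * antinorm \<omega> x"
  using surj_J omega_J_le[of v] antinorm_J by (metis mult.commute surjD)

text \<open>
  If \<open>\<omega> \<cdot> (-z)\<close> is norming for \<open>J y\<close> with respect to the antinorm, testing it on \<open>J z\<close> gives
  \<open>norm z \<le> norm y\<close>, while its value at \<open>J y\<close> says that \<open>\<omega> z (J y)\<close> is as large as this bound allows.
  For \<open>y \<noteq> 0\<close>, the points \<open>z\<close> and \<open>y\<close>, divided by \<open>norm y\<close>, lie on a common face of the unit ball, the one exposed by
  \<open>\<omega> \<cdot> (J y)\<close>, and by strict convexity they coincide.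
\<close>

lemma duality_map_antinorm: "duality_map (antinorm \<omega>) (J y) = (\<lambda>v. \<omega> v (- y))"
proof -
  have le: "\<omega> w z \<le> norm z * antinorm \<omega> w" for w z
    using omega_le_antinorm[of "- z" w] omega_skew[of w z] by (simp add: omega_simps)
  have *: "linear f \<and> dual_norm (antinorm \<omega>) f = antinorm \<omega> (J y) \<and> f (J y) = (antinorm \<omega> (J y))\<^sup>2
      \<longleftrightarrow> norming_functional (antinorm \<omega>) (J y) f" for f
  proof (rule norming_functional_iff_dual_norm)
    assume "linear f"
    then show "\<exists>C. \<forall>v. f v \<le> C * antinorm \<omega> v" using omega_represents le by metis
  qed (use nontriv antinorm_scale antinorm_pos in auto)
  have "norming_functional (antinorm \<omega>) (J y) f \<longleftrightarrow> f = (\<lambda>v. \<omega> v (- y))" for f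
  proof
    assume f: "norming_functional (antinorm \<omega>) (J y) f"
    then obtain z where z: "f = (\<lambda>v. \<omega> v (- z))"
      using omega_represents unfolding norming_functional_def by (metis minus_minus)
    have "norm z * norm z \<le> norm y * norm z"
    proof -
      have "f (J z) = (norm z)\<^sup>2" using omega_J_self[of z] omega_skew[of "J z" z] by (simp add: z omega_simps)
      moreover have "f (J z) \<le> norm y * norm z" using f unfolding norming_functional_def by (metis antinorm_J)
      ultimately show ?thesis by (simp add: power2_eq_square)
    qed
    then have zy: "norm z \<le> norm y" by (cases "z = 0") auto
    have att: "\<omega> z (J y) = (norm y)\<^sup>2"
      using f omega_skew[of "J y" z] by (simp add: norming_functional_def antinorm_J z omega_simps)
    have "z = y"
    proof (cases "y = 0")
      case True then show ?thesis using zy by simp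
    next
      case False
      define n where "n = norm y"
      have n: "n > 0" using False by (simp add: n_def)
      show "z = y"
      proof (rule ccontr)
        assume "z \<noteq> y"
        then have "z /\<^sub>R n \<noteq> y /\<^sub>R n" using n by simp
        moreover have "closed_segment (z /\<^sub>R n) (y /\<^sub>R n) \<subseteq> sphere 0 1"
        proof
          fix p assume p: "p \<in> closed_segment (z /\<^sub>R n) (y /\<^sub>R n)"
          have "z /\<^sub>R n \<in> cball 0 1" "y /\<^sub>R n \<in> cball 0 1"
            using n zy by (simp_all add: n_def field_simps)
          then have "p \<in> cball 0 1"
            using closed_segment_subset[OF _ _ convex_cball] p by blast
          moreover have "\<omega> p (J y) = n"
          proof -
            obtain u where "p = (1 - u) *\<^sub>R (z /\<^sub>R n) + u *\<^sub>R (y /\<^sub>R n)" using p by (auto simp: in_segment)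
            then have "\<omega> p (J y) = (1 - u) * (n\<^sup>2 / n) + u * (n\<^sup>2 / n)"
              by (simp add: linear_add[OF omega_linear(1)] omega_simps att omega_J_self n_def divide_inverse_commute)
            then show ?thesis using n by (simp add: power2_eq_square field_simps)
          qed
          ultimately show "p \<in> sphere 0 1" using omega_J_le[of p y] n by (simp add: n_def)
        qed
        ultimately show False using strict unfolding strictly_convex_space_def by blast
      qed
    qed
    then show "f = (\<lambda>v. \<omega> v (- y))" using z by simp
  next
    assume f: "f = (\<lambda>v. \<omega> v (- y))"
    have "f v \<le> norm y * antinorm \<omega> v" for v using le[of v "- y"] f by simp
    moreover have "f (J y) = (norm y)\<^sup>2"
      using omega_J_self[of y] omega_skew[of "J y" y] by (simp add: f omega_simps)
    ultimately show "norming_functional (antinorm \<omega>) (J y) f"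
      using omega_linear(1)[of "- y"] f by (simp add: norming_functional_def antinorm_J)
  qed
  then show ?thesis unfolding duality_map_def * by simp
qed

lemma J_anti_J: "J_anti (J y) = - y"
  by (rule normality_map_eq[OF duality_map_antinorm])

lemma J_J_anti: "J (J_anti x) = - x"
  using surj_J J_anti_J J_minus by (metis surjD)

section \<open>The bipolar theorem for the normality maps\<close>

text \<open>
  The graph \<open>G\<close> of \<open>J\<close> over \<open>M\<close> is cut out by the closed conditions of \<open>normality_map_iff\<close>, and its
  second components are bounded because each coordinate functional is of the form \<open>\<omega> w\<close>.
  Thus \<open>G\<close> is compact, and \<open>J ` M\<close> is its projection.
\<close>

lemma compact_J_image:
  assumes M: "compact M"
  shows "compact (J ` M)"
proof -
  have bb: "bounded_bilinear \<omega>"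
    by (rule finite_dim_bounded_bilinear[OF fin symplectic_formD(1)[OF sympl]])
  obtain R where R: "\<And>y. y \<in> M \<Longrightarrow> norm y \<le> R"
    using compact_imp_bounded[OF M] by (auto simp: bounded_iff)
  have "bounded (J ` M)"
  proof -
    obtain B and c :: "'a \<Rightarrow> 'a \<Rightarrow> real" where B: "finite B"
      and lin: "\<And>b. linear (c b)" and sum: "\<And>x. (\<Sum>b\<in>B. c b x *\<^sub>R b) = x"
      using finite_dim_coordinates[OF fin] by metis
    have "\<exists>w. \<forall>x. c b x = \<omega> w x" for b
    proof -
      obtain z where z: "c b = (\<lambda>v. \<omega> v z)" using omega_represents[OF lin] by blast
      have "c b x = \<omega> (- z) x" for x using omega_skew[of x z] by (simp add: z omega_simps)
      then show ?thesis by blast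
    qed
    then obtain w where w: "\<And>b x. c b x = \<omega> (w b) x" by metis
    have cb: "\<bar>c b (J y)\<bar> \<le> R * norm (w b)" if "y \<in> M" for b y
    proof -
      have "norm y * norm (w b) \<le> R * norm (w b)" by (intro mult_right_mono R that) simp
      then show ?thesis
        using omega_J_le[of "w b" y] omega_J_le[of "- w b" y] by (simp add: w omega_simps abs_le_iff)
    qed
    have "norm (J y) \<le> (\<Sum>b\<in>B. R * norm (w b) * norm b)" if "y \<in> M" for y
      by (subst sum[of "J y", symmetric], rule sum_norm_le)
         (use cb[OF that] in \<open>auto intro!: mult_right_mono\<close>)
    then show ?thesis by (auto simp: bounded_iff)
  qed
  then obtain S where S: "\<And>y. y \<in> M \<Longrightarrow> norm (J y) \<le> S" by (auto simp: bounded_iff)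
  define G where "G = (M \<times> cball 0 S) \<inter>
    ({(y, z). \<omega> y z = (norm y)\<^sup>2} \<inter> (\<Inter>v. {(y, z). \<omega> v z \<le> norm y * norm v}))"
  have "compact (cball (0::'a) S)" by (rule finite_dim_compact[OF fin]) auto
  then have "compact (M \<times> cball (0::'a) S)" using M by (intro compact_Times)
  moreover have "closed {(y, z). \<omega> y z = (norm y)\<^sup>2}"
    unfolding case_prod_beta by (intro closed_Collect_eq bounded_bilinear.continuous_on[OF bb] continuous_intros)
  moreover have "closed {(y, z). \<omega> v z \<le> norm y * norm v}" for v
    unfolding case_prod_beta by (intro closed_Collect_le bounded_bilinear.continuous_on[OF bb] continuous_intros)
  ultimately have "compact G"
    unfolding G_def by (intro compact_Int_closed closed_Int closed_INT) auto
  then have "compact (snd ` G)" by (intro compact_continuous_image continuous_intros)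
  moreover have "snd ` G = J ` M"
  proof -
    have "(y, z) \<in> G \<longleftrightarrow> y \<in> M \<and> z = J y" for y z
      using S normality_map_iff[of y z] omega_linear(1)
      by (auto simp: G_def norming_functional_def omega_J_le omega_J_self)
    then show ?thesis by force
  qed
  ultimately show ?thesis by simp
qed

text \<open>
  Every functional is of the form \<open>\<omega> m\<close>, so a functional separating \<open>x\<close> from \<open>C\<close> supplies a point \<open>m\<close> of
  the polar with \<open>\<omega> m x > 1\<close>; since \<open>0 \<in> C\<close>, the separating level \<open>d\<close> is positive and can be
  normalized to \<open>1\<close>.
\<close>

lemma symplectic_bipolar:
  assumes C: "compact C" "convex C" "0 \<in> C"
  shows "C = {x. \<forall>m. (\<forall>k\<in>C. \<omega> m k \<le> 1) \<longrightarrow> \<omega> m x \<le> 1}"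
proof
  show "{x. \<forall>m. (\<forall>k\<in>C. \<omega> m k \<le> 1) \<longrightarrow> \<omega> m x \<le> 1} \<subseteq> C"
  proof
    fix x assume "x \<in> {x. \<forall>m. (\<forall>k\<in>C. \<omega> m k \<le> 1) \<longrightarrow> \<omega> m x \<le> 1}"
    then have x: "\<And>m. (\<forall>k\<in>C. \<omega> m k \<le> 1) \<Longrightarrow> \<omega> m x \<le> 1" by blast
    show "x \<in> C"
    proof (rule ccontr)
      assume "x \<notin> C"
      moreover have "C \<noteq> {}" using C(3) by blast
      ultimately obtain f :: "'a \<Rightarrow> real" and a where f: "linear f" and le: "\<And>k. k \<in> C \<Longrightarrow> f k \<le> a" and ax: "a < f x"
        using finite_dim_separation[OF fin C(1,2), of x] by metis
      \<comment> \<open>The midpoint is positive even if \<open>a = 0\<close>, so that one can divide by it.\<close>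
      define d where "d = (a + f x) / 2"
      have "0 \<le> a" using le[OF C(3)] by (simp add: linear_0[OF f])
      then have d: "0 < d" "a < d" "d < f x" using ax by (auto simp: d_def)
      obtain z where z: "f = (\<lambda>v. \<omega> v z)" using omega_represents[OF f] by blast
      define m where "m = - (z /\<^sub>R d)"
      have m: "\<omega> m v = f v / d" for v
        using omega_skew[of z v] by (simp add: m_def omega_simps z divide_inverse_commute)
      have "\<forall>k\<in>C. \<omega> m k \<le> 1" using le d by (fastforce simp: m)
      then have "\<omega> m x \<le> 1" by (rule x)
      then show False using d by (simp add: m)
    qed
  qed
qed blast

text \<open>
  Passing to the convex hull changes no polar, since half-spaces are convex.
\<close>

lemma right_semi_polar_eq: "right_semi_polar K = {m. \<forall>k\<in>convex hull (J ` K). \<omega> m k \<le> 1}"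
proof -
  have "(\<forall>k\<in>convex hull (J ` K). \<omega> m k \<le> 1) \<longleftrightarrow> (\<forall>k\<in>J ` K. \<omega> m k \<le> 1)" for m
  proof
    assume "\<forall>k\<in>J ` K. \<omega> m k \<le> 1"
    then have "J ` K \<subseteq> {k. \<omega> m k \<le> 1}" by blast
    moreover have "convex {k. \<omega> m k \<le> 1}"
      using convex_linear_vimage[OF omega_linear(2) convex_real_interval(2)[of 1]] by (simp add: vimage_def)
    ultimately show "\<forall>k\<in>convex hull (J ` K). \<omega> m k \<le> 1" using hull_minimal[of "J ` K"] by blast
  qed (simp add: hull_inc)
  then show ?thesis by (simp add: right_semi_polar_def semi_inner_eq)
qed

lemma right_semi_polar_J_anti: "right_semi_polar (J_anti ` K) = {x. \<forall>m\<in>K. \<omega> m x \<le> 1}"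
proof -
  have "semi_inner x (J_anti m) = \<omega> m x" for x m
    using omega_skew[of x m] by (simp add: semi_inner_eq J_J_anti omega_simps)
  then show ?thesis by (simp add: right_semi_polar_def)
qed

theorem convex_hull_J_image:
  assumes M: "compact M" "0 \<in> M"
  shows "convex hull (J ` M) = right_semi_polar (J_anti ` right_semi_polar M)"
proof -
  let ?C = "convex hull (J ` M)"
  have "0 \<in> J ` M" using J_zero M(2) by force
  then have "?C = {x. \<forall>m. (\<forall>k\<in>?C. \<omega> m k \<le> 1) \<longrightarrow> \<omega> m x \<le> 1}"
    by (intro symplectic_bipolar finite_dim_compact_convex_hull[OF fin] compact_J_image M(1) hull_inc)
       (simp_all add: convex_convex_hull)
  then show ?thesis
    unfolding right_semi_polar_J_anti right_semi_polar_eq[of M] by simp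
qed

end

theorem theorem5p4:
  fixes \<omega> :: "'a::real_normed_vector \<Rightarrow> 'a \<Rightarrow> real" and M :: "'a set"
  assumes "\<exists>B::'a set. finite B \<and> span B = UNIV"
    and "even (dim (UNIV :: 'a set))"
    and "smooth_space TYPE('a)"
    and "strictly_convex_space TYPE('a)"
    and "symplectic_form \<omega>"
    and "convex_body M"
    and "0 \<in> interior M"
  shows "convex hull (normality_map \<omega> norm ` M) =
         right_semi_polar (normality_map \<omega> (antinorm \<omega>) ` right_semi_polar M)"
proof (cases "\<exists>v::'a. v \<noteq> 0")
  case True
  interpret smooth_symplectic_space \<omega>
    by (rule smooth_symplectic_space.intro[OF assms(1,3,4,5) True])
  have "compact M" "0 \<in> M"
    using assms(6,7) interior_subset by (auto simp: convex_body_def)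
  then show ?thesis by (rule convex_hull_J_image)
next
  case False
  then have zero: "x = y" for x y :: 'a by metis
  have trivial: "A = UNIV" if "x \<in> A" for A :: "'a set" and x
  proof -
    have "y \<in> A" for y using that zero[of y x] by simp
    then show ?thesis by blast
  qed
  have M: "0 \<in> M" using assms(7) interior_subset by blast
  \<comment> \<open>The value \<open>s\<close> is unspecified here: if \<open>s > 1\<close>, the polar of \<open>M\<close> is empty, and its polar is everything.\<close>
  define s where "s = semi_inner (0::'a) 0"
  have polar: "right_semi_polar K = (if K = {} \<or> s \<le> 1 then UNIV else {})" for K :: "'a set"
  proof -
    have "semi_inner x k = s" for x k :: 'a
      using zero[of x 0] zero[of k 0] by (simp add: s_def)
    then show ?thesis by (auto simp: right_semi_polar_def)
  qed
  have "normality_map \<omega> norm 0 \<in> convex hull (normality_map \<omega> norm ` M)"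
    using M by (intro hull_inc imageI)
  then have "convex hull (normality_map \<omega> norm ` M) = UNIV" by (rule trivial)
  moreover have "right_semi_polar (normality_map \<omega> (antinorm \<omega>) ` right_semi_polar M) = UNIV"
    unfolding polar using M by auto
  ultimately show ?thesis by simp
qed

end
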